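(* Let $n\ge 2$, let $\mathfrak g=\mathfrak{sl}(n,\mathbb R)$, let $K=SO(n)$, and for $0\le i\le \lfloor n/2\rfloor$ let $\mathfrak h_i$ be the Cartan subalgebra of $\mathfrak g$ associated to the admissible root system $F_i=\{e_1-e_2,e_3-e_4,\dots,e_{2i-1}-e_{2i}\}$ ($F_0=\emptyset$). Then there exist non-trivial elements $k\in K$ such that $k\,\mathfrak h_i\,k^{-1}=\mathfrak h_i$ for every $i$; namely, for every non-empty set $A$ of odd integers $j$ with $1\le j<n$, the product $k=\prod_{j\in A}J_j$ is such an element.
   Context: $K=SO(n)$ is the analytic subgroup with Lie algebra $\mathfrak k=\{X\in\mathfrak{sl}(n,\mathbb R):X^t=-X\}$, and acts on $\mathfrak g$ by conjugation. $e_i$ is the functional taking a diagonal matrix $D(h_1,\dots,h_n)$ to $h_i$. The Cartan subalgebra $\mathfrak h_i$ associated to $F_i$ consists of all trace-zero block diagonal matrices whose first $i$ diagonal blocks are $2\times 2$ blocks of the form $\begin{pmatrix} h_j&\theta_j\\-\theta_j&h_j\end{pmatrix}$ ($1\le j\le i$, $h_j,\theta_j\in\mathbb R$) and whose remaining diagonal blocks are of size one (so $\mathfrak h_0$ is the set of trace-zero diagonal matrices). For odd $j$ with $1\le j<n$, $J_j\in SO(n)$ is the block diagonal matrix whose $2\times 2$ diagonal block in rows and columns $j,j+1$ is $\begin{pmatrix}0&1\\-1&0\end{pmatrix}$ and which has diagonal entries $1$ elsewhere. *)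

theory Defs
  imports "Jordan_Normal_Form.Determinant" "HOL-Algebra.Group"
begin

definition trace_mat :: "'a :: comm_monoid_add mat \<Rightarrow> 'a" where
  "trace_mat X = (\<Sum>i<dim_row X. X $$ (i, i))"

definition sl :: "nat \<Rightarrow> real mat set" where
  "sl n = {X \<in> carrier_mat n n. trace_mat X = 0}"

definition SO :: "nat \<Rightarrow> real mat monoid" where
  "SO n = \<lparr>carrier = {Q \<in> carrier_mat n n. transpose_mat Q * Q = 1\<^sub>m n \<and> det Q = 1},
           mult = (*), one = 1\<^sub>m n\<rparr>"

lemma group_SO: "group (SO n)"
proof (rule groupI)
  fix x y assume "x \<in> carrier (SO n)" "y \<in> carrier (SO n)"
  then have x: "x \<in> carrier_mat n n" "transpose_mat x * x = 1\<^sub>m n" "det x = 1"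
    and y: "y \<in> carrier_mat n n" "transpose_mat y * y = 1\<^sub>m n" "det y = 1"
    by (auto simp: SO_def)
  have "transpose_mat (x * y) * (x * y) = transpose_mat y * (transpose_mat x * (x * y))"
    using x(1) y(1) by (simp add: transpose_mult[of _ n n _ n] assoc_mult_mat[of _ n n _ n _ n])
  also have "transpose_mat x * (x * y) = (transpose_mat x * x) * y"
    using x(1) y(1) by (simp add: assoc_mult_mat[of _ n n _ n _ n])
  also have "\<dots> = y" using x y by simp
  finally have "transpose_mat (x * y) * (x * y) = 1\<^sub>m n" using y by simp
  then show "x \<otimes>\<^bsub>SO n\<^esub> y \<in> carrier (SO n)"
    using x y by (auto simp: SO_def det_mult[of _ n])
next
  show "\<one>\<^bsub>SO n\<^esub> \<in> carrier (SO n)" by (simp add: SO_def)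
next
  fix x y z assume "x \<in> carrier (SO n)" "y \<in> carrier (SO n)" "z \<in> carrier (SO n)"
  then show "x \<otimes>\<^bsub>SO n\<^esub> y \<otimes>\<^bsub>SO n\<^esub> z = x \<otimes>\<^bsub>SO n\<^esub> (y \<otimes>\<^bsub>SO n\<^esub> z)"
    by (auto simp: SO_def assoc_mult_mat[of _ n n _ n _ n])
next
  fix x assume "x \<in> carrier (SO n)"
  then show "\<one>\<^bsub>SO n\<^esub> \<otimes>\<^bsub>SO n\<^esub> x = x" by (auto simp: SO_def)
next
  fix x assume "x \<in> carrier (SO n)"
  then have x: "x \<in> carrier_mat n n" "transpose_mat x * x = 1\<^sub>m n" "det x = 1"
    by (auto simp: SO_def)
  have "x * transpose_mat x = 1\<^sub>m n"
    using mat_mult_left_right_inverse[of "transpose_mat x" n x] x by simp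
  then have "transpose_mat x \<in> carrier (SO n)"
    using x by (simp add: SO_def det_transpose)
  then show "\<exists>y\<in>carrier (SO n). y \<otimes>\<^bsub>SO n\<^esub> x = \<one>\<^bsub>SO n\<^esub>"
    using x by (intro bexI[of _ "transpose_mat x"]) (auto simp: SO_def)
qed

definition conj_SO :: "nat \<Rightarrow> real mat \<Rightarrow> real mat \<Rightarrow> real mat" where
  "conj_SO n k X = k * X * inv\<^bsub>SO n\<^esub> k"

text \<open>The Cartan subalgebra attached to \<open>F\<^sub>i = {e\<^sub>1 - e\<^sub>2, \<dots>, e\<^sub>2\<^sub>i\<^sub>-\<^sub>1 - e\<^sub>2\<^sub>i}\<close>; meant for
  \<open>2 * i \<le> n\<close>. The \<open>2 \<times> 2\<close> block number \<open>j\<close> has parameters \<open>h j\<close> and \<open>\<theta> j\<close>; the blocks of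
  size one have entries \<open>d j\<close>.\<close>

definition cartan :: "nat \<Rightarrow> nat \<Rightarrow> real mat set" where
  "cartan n i = {X \<in> sl n. \<exists>h \<theta> d :: nat \<Rightarrow> real.
     X = diag_block_mat
           (map (\<lambda>j. mat_of_rows_list 2 [[h j, \<theta> j], [- \<theta> j, h j]]) [1..<i + 1] @
            map (\<lambda>j. mat_of_rows_list 1 [[d j]]) [2 * i + 1..<n + 1])}"

text \<open>Positions are counted from 1, as in the indices of \<open>e\<^sub>1, \<dots>, e\<^sub>n\<close>; meant for \<open>1 \<le> j < n\<close>.\<close>

definition J :: "nat \<Rightarrow> nat \<Rightarrow> real mat" where
  "J n j = diag_block_mat
     [1\<^sub>m (j - 1), mat_of_rows_list 2 [[0, 1], [- 1, 0]], 1\<^sub>m (n - (j + 1))]"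

text \<open>The matrices \<open>J n j\<close> with \<open>j\<close> odd commute (lemma \<open>J_commute\<close>), so the order of the factors
  is immaterial; the definition takes them in increasing order.\<close>

definition J_prod :: "nat \<Rightarrow> nat set \<Rightarrow> real mat" where
  "J_prod n A = foldr (\<lambda>j M. J n j * M) (sorted_list_of_set A) (1\<^sub>m n)"

lemma J_eq_mat:
  assumes "Suc m < n"
  shows "J n (Suc m) = mat n n (\<lambda>(p, q). if p = m then (if q = Suc m then 1 else 0)
    else if p = Suc m then (if q = m then - 1 else 0) else if p = q then 1 else 0)"
proof -
  define l where "l = n - Suc (Suc m)"
  then have l: "n = Suc (Suc (m + l))" using assms by simp
  have D: "diag_block_mat [B, C] =
      four_block_mat B (0\<^sub>m (dim_row B) (dim_col C)) (0\<^sub>m (dim_row C) (dim_col B)) C"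
    for B C :: "real mat"
    by (simp only: diag_block_mat.simps(2)[of B] diag_block_mat_singleton Let_def)
  have J: "J n (Suc m) = four_block_mat (1\<^sub>m m) (0\<^sub>m m (2 + l)) (0\<^sub>m (2 + l) m)
      (four_block_mat (mat_of_rows_list 2 [[0, 1], [- 1, 0]]) (0\<^sub>m 2 l) (0\<^sub>m l 2) (1\<^sub>m l))"
    unfolding J_def l diag_block_mat.simps(2)[of "1\<^sub>m (Suc m - 1)"] D Let_def
    by (simp add: mat_of_rows_list_def numeral_2_eq_2)
  have pos: "P p" if "\<And>p. p < m \<Longrightarrow> P p" "P m" "P (Suc m)" "\<And>r. P (Suc (Suc (m + r)))"
    for P and p :: nat
  proof -
    consider "p < m" | "p = m" | "p = Suc m" | "p = Suc (Suc (m + (p - Suc (Suc m))))"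
      by linarith
    then show ?thesis using that by cases metis+
  qed
  show ?thesis unfolding J unfolding l
  proof (rule eq_matI, goal_cases)
    case (1 p q)
    then have "p < Suc (Suc (m + l))" "q < Suc (Suc (m + l))" by simp_all
    then show ?case
    proof (induct p rule: pos)
      case (1 p) then show ?case
        by (induct q rule: pos) (simp_all add: mat_of_rows_list_def)
    next
      case 2 then show ?case
        by (induct q rule: pos) (simp_all add: mat_of_rows_list_def)
    next
      case 3 then show ?case
        by (induct q rule: pos) (simp_all add: mat_of_rows_list_def)
    next
      case (4 r) then show ?case
        by (induct q rule: pos) (simp_all add: mat_of_rows_list_def)
    qed
  qed (simp_all add: mat_of_rows_list_def)
qed

lemma J_carrier: "Suc m < n \<Longrightarrow> J n (Suc m) \<in> carrier_mat n n"
  by (simp add: J_eq_mat)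

lemma J_mult_index:
  assumes "Suc m < n" "M \<in> carrier_mat n n" "p < n" "q < n"
  shows "(J n (Suc m) * M) $$ (p, q) =
    (if p = m then M $$ (Suc m, q) else if p = Suc m then - M $$ (m, q) else M $$ (p, q))"
proof -
  have "(J n (Suc m) * M) $$ (p, q) = (\<Sum>r\<in>{0..<n}. J n (Suc m) $$ (p, r) * M $$ (r, q))"
    using assms J_carrier[OF assms(1)] by (simp add: scalar_prod_def)
  also have "\<dots> = (\<Sum>r\<in>{0..<n}. if r = (if p = m then Suc m else if p = Suc m then m else p)
      then (if p = Suc m then - M $$ (r, q) else M $$ (r, q)) else 0)"
    using assms by (intro sum.cong) (auto simp: J_eq_mat)
  also have "\<dots> = (if p = m then M $$ (Suc m, q) else if p = Suc m then - M $$ (m, q)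
      else M $$ (p, q))"
    using assms by (subst sum.delta) auto
  finally show ?thesis .
qed

lemma J_commute:
  assumes "odd j" "j < n" "odd k" "k < n"
  shows "J n j * J n k = J n k * J n j"
proof -
  obtain a b where ab: "j = Suc a" "k = Suc b" "even a" "even b"
    using assms by (cases j; cases k) auto
  have "a = b \<or> (a \<noteq> b \<and> Suc a \<noteq> b \<and> Suc b \<noteq> a)" using ab by auto
  moreover have "J n (Suc a) * J n (Suc b) = J n (Suc b) * J n (Suc a)"
    if "a \<noteq> b" "Suc a \<noteq> b" "Suc b \<noteq> a" "Suc a < n" "Suc b < n"
  proof (rule eq_matI, goal_cases)
    case (1 p q)
    then have "p < n" "q < n" using J_carrier[OF that(4)] J_carrier[OF that(5)] by auto
    then show ?case
      using that by (simp add: J_mult_index J_carrier) (simp add: J_eq_mat)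
  qed (use J_carrier[OF that(4)] J_carrier[OF that(5)] in auto)
  ultimately show ?thesis using ab assms by auto
qed

end

theory Submission imports Defs
begin

text \<open>For odd \<open>j\<close>, conjugation by \<open>J n j\<close> only affects the rows and columns \<open>j, j + 1\<close>. If these
  carry a \<open>2 \<times> 2\<close> block of the Cartan subalgebra, the block commutes with the quarter turn; if they
  carry two blocks of size one, the two diagonal entries are exchanged. So each \<open>J n j\<close> acts on
  every Cartan subalgebra as an involution, and the products of the \<open>J n j\<close> act by compositions.\<close>

section \<open>Determinants of block diagonal matrices and the cyclic trace\<close>

lemma det_diag_block_mat:
  assumes "\<And>A. A \<in> set As \<Longrightarrow> dim_row A = dim_col A"
  shows "det (diag_block_mat As) = prod_list (map det (As :: 'a :: idom mat list))"
  using assms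
proof (induction As)
  case (Cons A As)
  let ?B = "diag_block_mat As"
  have "square_mat ?B"
    using Cons.prems by (intro diag_block_mat_square) auto
  then have "det (diag_block_mat (A # As)) = det A * det ?B"
    using Cons.prems unfolding diag_block_mat.simps Let_def
    by (intro det_four_block_mat_lower_left_zero[where n = "dim_row A" and m = "dim_row ?B"]) auto
  then show ?case using Cons by simp
qed simp

lemma det_2x2: "det (mat_of_rows_list 2 [[a, b], [c, d]]) = a * d - b * (c :: 'a :: comm_ring_1)"
proof -
  have "mat_of_rows_list 2 [[a, b], [c, d]] \<in> carrier_mat 2 2"
    by (rule carrier_matI) (simp_all add: mat_of_rows_list_def)
  then show ?thesis
    by (subst laplace_expansion_row[of _ 2 0])
      (auto simp: mat_of_rows_list_def cofactor_def numeral_2_eq_2 mat_delete_def det_single)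
qed

lemma trace_mat_mult_commute:
  fixes A :: "'a :: comm_semiring_0 mat"
  assumes "A \<in> carrier_mat n m" "B \<in> carrier_mat m n"
  shows "trace_mat (A * B) = trace_mat (B * A)"
proof -
  have "trace_mat (A * B) = (\<Sum>i<n. \<Sum>j<m. A $$ (i, j) * B $$ (j, i))"
    using assms by (auto simp: trace_mat_def scalar_prod_def lessThan_atLeast0)
  also have "\<dots> = (\<Sum>j<m. \<Sum>i<n. B $$ (j, i) * A $$ (i, j))"
    by (subst sum.swap) (simp add: mult.commute)
  also have "\<dots> = trace_mat (B * A)"
    using assms by (auto simp: trace_mat_def scalar_prod_def lessThan_atLeast0)
  finally show ?thesis .
qed

section \<open>A single \<open>J n j\<close> as an element of the rotation group\<close>

text \<open>\<open>J n (Suc m)\<close> is a signed permutation matrix: \<open>s\<close> is the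
  transposition of the two rows and \<open>e\<close> records the sign carried by the second
  one.\<close>

lemma J_conj_index:
  assumes "Suc m < n" "X \<in> carrier_mat n n" "p < n" "q < n"
  defines "s \<equiv> \<lambda>r. if r = m then Suc m else if r = Suc m then m else r"
    and "e \<equiv> \<lambda>r. if r = Suc m then - 1 else 1"
  shows "(J n (Suc m) * X * transpose_mat (J n (Suc m))) $$ (p, q) = e p * e q * X $$ (s p, s q)"
proof -
  \<comment> \<open>Rewriting the right factor through a transpose lets the row formula
    \<open>J_mult_index\<close> serve for the columns as well.\<close>
  have "J n (Suc m) * X * transpose_mat (J n (Suc m))
      = J n (Suc m) * transpose_mat (J n (Suc m) * transpose_mat X)"
    using assms J_carrier[OF assms(1)]
    by (simp add: transpose_mult[of _ n n _ n] assoc_mult_mat[of _ n n _ n _ n])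
  then show ?thesis
    using assms J_carrier[OF assms(1)]
    by (simp add: J_mult_index del: index_mult_mat(1))
qed

lemma J_mult_transpose:
  assumes "Suc m < n"
  shows "J n (Suc m) * transpose_mat (J n (Suc m)) = 1\<^sub>m n"
proof (rule eq_matI, goal_cases)
  case (1 p q)
  then show ?case
    using J_conj_index[OF assms, of "1\<^sub>m n" p q] assms J_carrier[OF assms] by auto
qed (use J_carrier[OF assms] in auto)

lemma J_in_SO:
  assumes "Suc m < n"
  shows "J n (Suc m) \<in> carrier (SO n)"
proof -
  have "det (J n (Suc m)) = 1"
    unfolding J_def
    by (subst det_diag_block_mat) (auto simp: det_2x2, auto simp: mat_of_rows_list_def)
  moreover have "transpose_mat (J n (Suc m)) * J n (Suc m) = 1\<^sub>m n"
    using mat_mult_left_right_inverse[OF _ _ J_mult_transpose[OF assms]] J_carrier[OF assms]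
    by simp
  ultimately show ?thesis
    using J_carrier[OF assms] by (simp add: SO_def)
qed

section \<open>Inverses and conjugation in SO(n)\<close>

lemma inv_SO:
  assumes "k \<in> carrier (SO n)"
  shows "inv\<^bsub>SO n\<^esub> k = transpose_mat k"
proof (rule group.inv_equality[OF group_SO])
  have k: "k \<in> carrier_mat n n" "transpose_mat k * k = 1\<^sub>m n" "det k = 1"
    using assms by (auto simp: SO_def)
  then show "transpose_mat k \<otimes>\<^bsub>SO n\<^esub> k = \<one>\<^bsub>SO n\<^esub>"
    by (simp add: SO_def)
  have "k * transpose_mat k = 1\<^sub>m n"
    using mat_mult_left_right_inverse[of "transpose_mat k" n k] k by simp
  then show "transpose_mat k \<in> carrier (SO n)"
    using k by (simp add: SO_def det_transpose)
qed (rule assms)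

lemma conj_SO_mult:
  assumes "k \<in> carrier (SO n)" "l \<in> carrier (SO n)" "X \<in> carrier_mat n n"
  shows "conj_SO n (k * l) X = conj_SO n k (conj_SO n l X)"
proof -
  have "k * l \<in> carrier (SO n)"
    using group.is_monoid[OF group_SO, THEN monoid.m_closed, OF assms(1,2)] by (simp add: SO_def)
  moreover have "k \<in> carrier_mat n n" "l \<in> carrier_mat n n"
    using assms by (auto simp: SO_def)
  ultimately show ?thesis
    using assms by (simp add: conj_SO_def inv_SO transpose_mult[of _ n n _ n]
        assoc_mult_mat[of _ n n _ n _ n])
qed

lemma conj_SO_in_sl:
  assumes k: "k \<in> carrier (SO n)" and X: "X \<in> sl n"
  shows "conj_SO n k X \<in> sl n"
proof -
  have c: "k \<in> carrier_mat n n" "transpose_mat k * k = 1\<^sub>m n" "X \<in> carrier_mat n n"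
    using assms by (auto simp: SO_def sl_def)
  have "trace_mat (k * X * transpose_mat k) = trace_mat (transpose_mat k * (k * X))"
    using c by (intro trace_mat_mult_commute[of _ n n]) auto
  also have "transpose_mat k * (k * X) = X"
    using c by (simp flip: assoc_mult_mat[of _ n n _ n _ n])
  finally show ?thesis
    using c X by (simp add: sl_def conj_SO_def inv_SO[OF k])
qed

section \<open>Entrywise description of the Cartan subalgebras\<close>

lemma diag_block_mat_scalars:
  "diag_block_mat (map (\<lambda>j. mat_of_rows_list 1 [[d j]]) [a..<b]) =
    mat (b - a) (b - a) (\<lambda>(p, q). if p = q then d (a + p) else (0 :: 'a :: zero))"
proof (induction "b - a" arbitrary: a)
  case (Suc l)
  then have ab: "a < b" and l: "l = b - Suc a" by auto
  show ?case
    unfolding upt_conv_Cons[OF ab] list.map diag_block_mat.simps Let_def Suc(1)[OF l]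
    using ab by (intro eq_matI) (auto simp: mat_of_rows_list_def)
qed auto

lemma diag_block_mat_2x2:
  "diag_block_mat (map (\<lambda>j. mat_of_rows_list 2 [[a j, b j], [c j, d j]]) [k..<l]) =
    mat (2 * (l - k)) (2 * (l - k)) (\<lambda>(p, q). if p div 2 \<noteq> q div 2 then 0 else
      (if even p then if even q then a else b else if even q then c else d) (k + p div 2)
        :: 'a :: zero)"
proof (induction "l - k" arbitrary: k)
  case (Suc r)
  then have kl: "k < l" and r: "r = l - Suc k" by auto
  \<comment> \<open>Indices 0 and 1 belong to the leading block; any other index is shifted by two
    into the tail, which the induction hypothesis covers.\<close>
  have pos: "p = 0 \<or> p = 1 \<or> (\<exists>p'. p = Suc (Suc p'))" for p :: nat
    by (cases p; cases "p - 1") auto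
  have r': "2 * (l - k) = Suc (Suc (2 * (l - Suc k)))" using kl by simp
  show ?case
    unfolding upt_conv_Cons[OF kl] list.map diag_block_mat.simps Let_def Suc(1)[OF r] r'
  proof (intro eq_matI, goal_cases)
    case (1 p q)
    then show ?case
      by (insert pos[of p] pos[of q], elim disjE exE) (simp_all add: mat_of_rows_list_def)
  qed (simp_all add: mat_of_rows_list_def)
qed auto

text \<open>Matrix indices start at 0, so the \<open>2 \<times> 2\<close> blocks sit in the rows
  \<open>2 * j, 2 * j + 1\<close> with \<open>j < i\<close>.\<close>

lemma mem_cartan_iff:
  assumes "2 * i \<le> n"
  shows "X \<in> cartan n i \<longleftrightarrow> X \<in> sl n \<and>
    (\<forall>p<n. \<forall>q<n. p \<noteq> q \<longrightarrow> p div 2 \<noteq> q div 2 \<or> 2 * i \<le> p \<longrightarrow> X $$ (p, q) = 0) \<and>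
    (\<forall>j<i. X $$ (Suc (2 * j), Suc (2 * j)) = X $$ (2 * j, 2 * j) \<and>
           X $$ (Suc (2 * j), 2 * j) = - X $$ (2 * j, Suc (2 * j)))"
    (is "_ \<longleftrightarrow> _ \<and> ?zero X \<and> ?block X")
proof -
  \<comment> \<open>The parameters are numbered from 1 and the indices from 0, hence
    \<open>1 + p div 2\<close> for blocks and \<open>Suc p\<close> for scalars.\<close>
  define N where "N h \<theta> d = mat n n (\<lambda>(p, q).
    if p < 2 * i \<and> q < 2 * i then if p div 2 \<noteq> q div 2 then 0 else
      (if even p then if even q then h else \<theta> else if even q then \<lambda>j. - \<theta> j else h) (1 + p div 2)
    else if p = q then d (Suc p) else 0)" for h \<theta> d :: "nat \<Rightarrow> real"
  have N: "diag_block_mat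
           (map (\<lambda>j. mat_of_rows_list 2 [[h j, \<theta> j], [- \<theta> j, h j]]) [1..<i + 1] @
            map (\<lambda>j. mat_of_rows_list 1 [[d j]]) [2 * i + 1..<n + 1]) = N h \<theta> d" for h \<theta> d
    unfolding diag_block_mat_append diag_block_mat_2x2 diag_block_mat_scalars N_def Let_def
  proof (rule eq_matI, goal_cases)
    case (1 p q)
    then show ?case
      using assms by (cases "p < 2 * i"; cases "q < 2 * i") auto
  qed (use assms in auto)
  have "?zero X \<and> ?block X \<longleftrightarrow> (\<exists>h \<theta> d. X = N h \<theta> d)" if X: "X \<in> sl n"
  proof
    assume "\<exists>h \<theta> d. X = N h \<theta> d"
    then show "?zero X \<and> ?block X" using assms by (auto simp: N_def)
  next
    assume *: "?zero X \<and> ?block X"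
    \<comment> \<open>The parameters are read off from the top row of each block and from the
      diagonal; \<open>j - 1\<close> undoes the numbering from 1.\<close>
    let ?h = "\<lambda>j. X $$ (2 * (j - 1), 2 * (j - 1))"
    let ?t = "\<lambda>j. X $$ (2 * (j - 1), Suc (2 * (j - 1)))"
    let ?d = "\<lambda>j. X $$ (j - 1, j - 1)"
    have "X = N ?h ?t ?d"
    proof (rule eq_matI, goal_cases)
      case (1 p q)
      then have pq: "p < n" "q < n" by (auto simp: N_def)
      show ?case
      proof (cases "p < 2 * i \<and> p div 2 = q div 2")
        case True
        define j where "j = p div 2"
        have div2: "r = 2 * (r div 2) \<or> r = Suc (2 * (r div 2))" for r :: nat by presburger
        have "p = 2 * j \<or> p = Suc (2 * j)" "q = 2 * j \<or> q = Suc (2 * j)" "j < i"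
          using True div2[of p] div2[of q] less_mult_imp_div_less[of p i 2]
          by (simp_all add: j_def mult.commute)
        moreover from \<open>j < i\<close> have "X $$ (Suc (2 * j), Suc (2 * j)) = X $$ (2 * j, 2 * j)"
          "X $$ (Suc (2 * j), 2 * j) = - X $$ (2 * j, Suc (2 * j))"
          "2 * j < 2 * i" "Suc (2 * j) < 2 * i"
          using * by auto
        ultimately show ?thesis using pq unfolding N_def by (elim disjE) simp_all
      next
        case False
        then have "X $$ (p, q) = 0" if "p \<noteq> q"
          using * pq that by (metis linorder_not_le)
        with False show ?thesis using pq unfolding N_def by (cases "p = q") auto
      qed
    qed (use X in \<open>auto simp: N_def sl_def\<close>)
    then show "\<exists>h \<theta> d. X = N h \<theta> d" by blast
  qed
  then show ?thesis unfolding cartan_def N by blast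
qed

section \<open>Action of a single \<open>J n j\<close> on the Cartan subalgebras\<close>

text \<open>As \<open>m\<close> is even, \<open>s\<close> respects the pairs of indices
  \<open>2 * j\<close>, \<open>2 * j + 1\<close>, so the zero pattern survives. The square of
  \<open>J n (Suc m)\<close> is -1 on pair \<open>k\<close> and the identity elsewhere, so
  conjugating twice only flips entries linking that pair to other indices, and these vanish on the
  Cartan subalgebra.\<close>

lemma conj_J_cartan:
  assumes "2 * i \<le> n" "even m" "Suc m < n" "X \<in> cartan n i"
  shows conj_J_in_cartan: "conj_SO n (J n (Suc m)) X \<in> cartan n i"
    and conj_J_involution: "conj_SO n (J n (Suc m)) (conj_SO n (J n (Suc m)) X) = X"
proof -
  let ?Y = "conj_SO n (J n (Suc m)) X"
  define s where "s r = (if r = m then Suc m else if r = Suc m then m else r)" for r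
  define e :: "nat \<Rightarrow> real" where "e r = (if r = Suc m then - 1 else 1)" for r
  obtain k where k: "m = 2 * k" using \<open>even m\<close> by blast
  have X: "X \<in> sl n" "X \<in> carrier_mat n n"
    using assms by (auto simp: cartan_def sl_def)
  have index: "conj_SO n (J n (Suc m)) Z $$ (p, q) = e p * e q * Z $$ (s p, s q)"
    if "Z \<in> carrier_mat n n" "p < n" "q < n" for Z p q
    unfolding conj_SO_def inv_SO[OF J_in_SO[OF assms(3)]] e_def s_def
    using assms that by (intro J_conj_index)
  note Y = index[OF X(2)]
  have s: "s r < n" "s r div 2 = r div 2" if "r < n" for r
    using that assms by (auto simp: s_def k)
  have s': "2 * i \<le> s r \<longleftrightarrow> 2 * i \<le> r" "s r = s t \<longleftrightarrow> r = t" for r t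
    unfolding s_def k by presburger+
  show "?Y \<in> cartan n i"
    unfolding mem_cartan_iff[OF assms(1)]
  proof (intro conjI allI impI)
    show "?Y \<in> sl n" by (intro conj_SO_in_sl J_in_SO assms X)
  next
    fix p q assume "p < n" "q < n" "p \<noteq> q" "p div 2 \<noteq> q div 2 \<or> 2 * i \<le> p"
    then show "?Y $$ (p, q) = 0"
      using assms(4) unfolding mem_cartan_iff[OF assms(1)] by (simp add: Y s s')
  next
    fix j assume j: "j < i"
    then have "2 * j < n" "Suc (2 * j) < n" using assms(1) by auto
    moreover have "2 * j \<noteq> Suc (2 * k)" "Suc (2 * j) \<noteq> 2 * k" by presburger+
    moreover have "X $$ (Suc (2 * j), Suc (2 * j)) = X $$ (2 * j, 2 * j)"
      "X $$ (Suc (2 * j), 2 * j) = - X $$ (2 * j, Suc (2 * j))"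
      using assms(4) j unfolding mem_cartan_iff[OF assms(1)] by blast+
    \<comment> \<open>For \<open>j = k\<close> the swap and the sign together restore the block; for
      any other \<open>j\<close> the block is untouched.\<close>
    moreover have "j = k \<or> j \<noteq> k" by blast
    ultimately show "?Y $$ (Suc (2 * j), Suc (2 * j)) = ?Y $$ (2 * j, 2 * j)"
      "?Y $$ (Suc (2 * j), 2 * j) = - ?Y $$ (2 * j, Suc (2 * j))"
      by (simp_all only: Y) (auto simp: s_def e_def k)
  qed
  have ss: "s (s r) = r" for r by (simp add: s_def)
  have "?Y \<in> carrier_mat n n"
    using \<open>?Y \<in> cartan n i\<close> by (simp add: cartan_def sl_def)
  note YY = index[OF this]
  have ee: "e r * e (s r) = (if r div 2 = k then - 1 else 1)" for r
  proof -
    have "r div 2 = k \<longleftrightarrow> r = m \<or> r = Suc m" unfolding k by presburger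
    then show ?thesis by (auto simp: e_def s_def)
  qed
  show "conj_SO n (J n (Suc m)) ?Y = X"
  proof (rule eq_matI, goal_cases)
    case (1 p q)
    then have pq: "p < n" "q < n" using X by auto
    have "conj_SO n (J n (Suc m)) ?Y $$ (p, q) =
        (e p * e (s p)) * (e q * e (s q)) * X $$ (s (s p), s (s q))"
      using pq by (simp only: YY Y s mult.assoc mult.left_commute)
    also have "\<dots> = X $$ (p, q)"
    \<comment> \<open>Within one pair the two sign factors agree and cancel; across different pairs
      the entry itself is zero.\<close>
    proof (cases "p div 2 = q div 2")
      case True
      then show ?thesis unfolding ee ss by simp
    next
      case False
      then have "X $$ (p, q) = 0"
        using assms(4) pq unfolding mem_cartan_iff[OF assms(1)] by metis
      then show ?thesis unfolding ss by simp
    qed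
    finally show ?case .
  qed (use X J_carrier[OF assms(3)] in \<open>auto simp: conj_SO_def inv_SO J_in_SO[OF assms(3)]\<close>)
qed

text \<open>The involution supplies preimages, which turns the inclusion into an equality.\<close>

lemma conj_J_image_cartan:
  assumes "2 * i \<le> n" "even m" "Suc m < n"
  shows "conj_SO n (J n (Suc m)) ` cartan n i = cartan n i"
proof (intro equalityI image_subsetI subsetI)
  fix X assume "X \<in> cartan n i"
  then show "conj_SO n (J n (Suc m)) X \<in> cartan n i"
    and "X \<in> conj_SO n (J n (Suc m)) ` cartan n i"
    using conj_J_in_cartan[OF assms, of X] conj_J_involution[OF assms, of X]
    by (auto intro: rev_image_eqI[of "conj_SO n (J n (Suc m)) X"])
qed

section \<open>Products of the \<open>J n j\<close>\<close>

lemma foldr_J_in_SO: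
  assumes "set js \<subseteq> {j. odd j \<and> j < n}"
  shows "foldr (\<lambda>j M. J n j * M) js (1\<^sub>m n) \<in> carrier (SO n)"
  using assms
proof (induction js)
  case (Cons j js)
  then have "J n j \<in> carrier (SO n)" using J_in_SO[of "j - 1" n] by (cases j) auto
  then show ?case
    using Cons monoid.m_closed[OF group.is_monoid[OF group_SO], of "J n j" n]
    by (simp add: SO_def)
qed (simp add: SO_def)

lemma foldr_J_image_cartan:
  assumes "set js \<subseteq> {j. odd j \<and> j < n}" "2 * i \<le> n"
  shows "conj_SO n (foldr (\<lambda>j M. J n j * M) js (1\<^sub>m n)) ` cartan n i = cartan n i"
  using assms(1)
proof (induction js)
  case Nil
  have "1\<^sub>m n \<in> carrier (SO n)" by (simp add: SO_def)
  then have "conj_SO n (1\<^sub>m n) X = X" if "X \<in> cartan n i" for X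
    using that by (auto simp: conj_SO_def inv_SO cartan_def sl_def)
  then show ?case by simp
next
  case (Cons j js)
  let ?M = "foldr (\<lambda>j M. J n j * M) js (1\<^sub>m n)"
  obtain m where m: "j = Suc m" "even m" "Suc m < n" using Cons.prems by (cases j) auto
  have "conj_SO n (J n j * ?M) ` cartan n i = conj_SO n (J n j) ` conj_SO n ?M ` cartan n i"
    unfolding image_image using Cons.prems
    by (intro image_cong conj_SO_mult) (auto simp: m J_in_SO foldr_J_in_SO cartan_def sl_def)
  then show ?case using Cons m conj_J_image_cartan[OF assms(2)] by simp
qed

text \<open>A factor \<open>J n (Suc l)\<close> with \<open>l\<close> even changes only rows
  \<open>l\<close> and \<open>Suc l\<close>. By parity, row \<open>Suc m\<close> could be changed
  only by \<open>J n (Suc m)\<close>, which is absent, so it stays a row of the identity.\<close>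

lemma foldr_J_row:
  assumes "set js \<subseteq> {j. odd j \<and> j < n}" "even m" "Suc m < n" "Suc m \<notin> set js" "q < n"
  shows "foldr (\<lambda>j M. J n j * M) js (1\<^sub>m n) $$ (Suc m, q) = (if q = Suc m then 1 else 0)"
  using assms(1,4)
proof (induction js)
  case (Cons j js)
  obtain l where l: "j = Suc l" "even l" "Suc l < n" using Cons.prems by (cases j) auto
  moreover have "foldr (\<lambda>j M. J n j * M) js (1\<^sub>m n) \<in> carrier_mat n n"
    using foldr_J_in_SO[of js n] Cons.prems by (simp add: SO_def)
  moreover have "l \<noteq> Suc m" using l assms by auto
  ultimately show ?case using Cons assms by (auto simp: J_mult_index simp del: index_mult_mat(1))
qed (use assms in auto)

text \<open>The first factor moves row \<open>Suc m\<close> of the remaining product into row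
  \<open>m\<close>. Distinctness makes that row a unit vector, so the diagonal entry at
  \<open>m\<close> is 0 instead of 1.\<close>

lemma foldr_J_neq_one:
  assumes "set js \<subseteq> {j. odd j \<and> j < n}" "distinct js" "js \<noteq> []"
  shows "foldr (\<lambda>j M. J n j * M) js (1\<^sub>m n) \<noteq> 1\<^sub>m n"
proof (cases js)
  case (Cons j ks)
  let ?M = "foldr (\<lambda>j M. J n j * M) ks (1\<^sub>m n)"
  obtain m where m: "j = Suc m" "even m" "Suc m < n" using assms Cons by (cases j) auto
  have "?M \<in> carrier_mat n n"
    using foldr_J_in_SO[of ks n] assms Cons by (simp add: SO_def)
  then have "(J n j * ?M) $$ (m, m) = 0"
    using m assms Cons by (simp add: J_mult_index foldr_J_row del: index_mult_mat(1))
  moreover have "(1\<^sub>m n :: real mat) $$ (m, m) = 1" using m by simp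
  ultimately have "J n j * ?M \<noteq> 1\<^sub>m n" by (metis zero_neq_one)
  then show ?thesis using Cons by simp
qed (use assms in auto)

theorem proposition4p1:
  fixes n :: nat
  assumes "n \<ge> 2"
  shows "(\<exists>k\<in>carrier (SO n). k \<noteq> \<one>\<^bsub>SO n\<^esub> \<and>
            (\<forall>i\<le>n div 2. conj_SO n k ` cartan n i = cartan n i)) \<and>
         (\<forall>A. A \<noteq> {} \<and> A \<subseteq> {j. odd j \<and> 1 \<le> j \<and> j < n} \<longrightarrow>
            J_prod n A \<in> carrier (SO n) \<and> J_prod n A \<noteq> \<one>\<^bsub>SO n\<^esub> \<and>
            (\<forall>i\<le>n div 2. conj_SO n (J_prod n A) ` cartan n i = cartan n i))"
    (is "_ \<and> (\<forall>A. ?adm A \<longrightarrow> ?good (J_prod n A))")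
proof -
  have good: "?good (J_prod n A)" if "?adm A" for A
  proof -
    \<comment> \<open>Finiteness matters because \<open>sorted_list_of_set\<close> returns the empty
      list on infinite sets.\<close>
    have "finite A" using that finite_subset[of A "{..<n}"] by auto
    then have "set (sorted_list_of_set A) \<subseteq> {j. odd j \<and> j < n}" "sorted_list_of_set A \<noteq> []"
      using that by auto
    then show ?thesis
      unfolding J_prod_def
      using foldr_J_in_SO foldr_J_image_cartan foldr_J_neq_one by (auto simp: SO_def)
  qed
  \<comment> \<open>The bound on \<open>n\<close> makes 1 an admissible index, so
    \<open>J_prod n {1}\<close> witnesses the existence claim.\<close>
  have "?adm {1}" using assms by auto
  from good[OF this] show ?thesis
    by (intro conjI[OF bexI[of _ "J_prod n {1}"]] allI impI good) simp_all
qed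

end
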